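(* Let $M,N$ be Polish spaces, $c:M\times N\to\mathbb{R}\cup\{+\infty\}$ a cost function, $\mu \in \mathcal{P}(M)$, $\nu \in \mathcal{P}(N)$, and let $T: M \to N$ be an optimal transport map from $\mu$ to $\nu$ for the cost $c$. Assume that $T$ is induced by a potential $\psi : N \to \mathbb{R}$ which is strongly $c$-concave with modulus $\omega$ on a compact subset $D$ of $M\times N$ which contains the graph of $T$. Then any transport plan $\gamma \in \Gamma(\mu, \nu)$ supported on $D$ satisfies $$\int_{M \times N} \omega(d_N(T(x),y))\, d\gamma(x,y) \leq \int_{M \times N} c(x,y)\, d\gamma(x,y) - \int_M c(x,T(x))\, d\mu(x).$$
   Context: $\mathcal{P}(X)$ is the set of Borel probability measures on $X$; $d_N$ is the distance on $N$; $\Gamma(\mu,\nu)$ is the set of transport plans, i.e. probability measures on $M\times N$ with marginals $\mu$ and $\nu$. Standing assumption on the cost: $c$ is lower semi-continuous and bounded below. A transport map from $\mu$ to $\nu$ is a measurable map $T:M\to N$ with $T_\#\mu=\nu$; it is optimal if it minimizes $\int_M c(x,T(x))\,d\mu(x)$ among such maps. A map $T$ is induced by a potential $\psi:N\to\mathbb{R}$ if $T(x)\in \operatorname{argmin}_{y\in N}\, c(x,y)-\psi(y)$ for every $x\in M$. The $c$-superdifferential of $\psi$ at $y\in N$ is $\partial^c \psi(y) = \{x \in M \mid \forall z \in N,\ \psi(z) - c(x,z) \leq \psi(y) - c(x,y)\}$, and $\psi$ is $c$-concave if $\partial^c\psi(y)\neq\emptyset$ for every $y\in N$. A modulus is an increasing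 function $\omega:\mathbb{R}_+\to\mathbb{R}_+$ with $\omega(0)=0$. A $c$-concave function $\psi$ is strongly $c$-concave on $D\subseteq M\times N$ with modulus $\omega$ if for all $x,y,z$ such that $(x,y) \in D$, $(x,z) \in D$ and $x \in \partial^c \psi(y)$ one has $\psi(z) - c(x,z) \leq \psi(y) - c(x, y) - \omega(d_N(y,z))$.
   Formalization: The potential ψ is additionally assumed to be ν-measurable (measurable for the completion of ν); without this, the axiom of choice yields non-measurable potentials for which the inequality fails. *)

theory Defs
  imports "HOL-Probability.Probability"
begin

definition lower_semicontinuous :: "('a::topological_space \<Rightarrow> ereal) \<Rightarrow> bool" where
  "lower_semicontinuous f \<longleftrightarrow> (\<forall>a. open {x. a < f x})"

definition bounded_below :: "('a \<Rightarrow> ereal) \<Rightarrow> bool" where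
  "bounded_below f \<longleftrightarrow> (\<exists>b::real. \<forall>x. ereal b \<le> f x)"

(* Lebesgue integral of an extended-real function, as the integral of the positive part minus
   the integral of the negative part (e2ennreal sends negative numbers to 0). It is used below
   only for functions that are bounded below, on probability spaces, so the subtracted term is
   always finite. *)
definition ereal_integral :: "'a measure \<Rightarrow> ('a \<Rightarrow> ereal) \<Rightarrow> ereal" where
  "ereal_integral M f =
     enn2ereal (\<integral>\<^sup>+ x. e2ennreal (f x) \<partial>M) - enn2ereal (\<integral>\<^sup>+ x. e2ennreal (- f x) \<partial>M)"

definition borel_prob :: "'a::topological_space measure set" where
  "borel_prob = {\<mu>. prob_space \<mu> \<and> sets \<mu> = sets borel}"

definition transport_plans ::
    "'m::topological_space measure \<Rightarrow> 'n::topological_space measure \<Rightarrow> ('m \<times> 'n) measure set" where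
  "transport_plans \<mu> \<nu> =
     {\<gamma> \<in> borel_prob. distr \<gamma> borel fst = \<mu> \<and> distr \<gamma> borel snd = \<nu>}"

definition transport_map ::
    "'m::topological_space measure \<Rightarrow> 'n::topological_space measure \<Rightarrow> ('m \<Rightarrow> 'n) \<Rightarrow> bool" where
  "transport_map \<mu> \<nu> T \<longleftrightarrow> T \<in> borel \<rightarrow>\<^sub>M borel \<and> distr \<mu> borel T = \<nu>"

definition optimal_transport_map ::
    "('m::topological_space \<times> 'n::topological_space \<Rightarrow> ereal) \<Rightarrow> 'm measure \<Rightarrow> 'n measure
      \<Rightarrow> ('m \<Rightarrow> 'n) \<Rightarrow> bool" where
  "optimal_transport_map c \<mu> \<nu> T \<longleftrightarrow>
     is_arg_min (\<lambda>S. ereal_integral \<mu> (\<lambda>x. c (x, S x))) (transport_map \<mu> \<nu>) T"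

definition induced_by_potential ::
    "('m \<times> 'n \<Rightarrow> ereal) \<Rightarrow> ('n \<Rightarrow> real) \<Rightarrow> ('m \<Rightarrow> 'n) \<Rightarrow> bool" where
  "induced_by_potential c \<psi> T \<longleftrightarrow>
     (\<forall>x. is_arg_min (\<lambda>y. c (x, y) - ereal (\<psi> y)) (\<lambda>_. True) (T x))"

definition c_superdifferential ::
    "('m \<times> 'n \<Rightarrow> ereal) \<Rightarrow> ('n \<Rightarrow> real) \<Rightarrow> 'n \<Rightarrow> 'm set" where
  "c_superdifferential c \<psi> y =
     {x. \<forall>z. ereal (\<psi> z) - c (x, z) \<le> ereal (\<psi> y) - c (x, y)}"

definition c_concave :: "('m \<times> 'n \<Rightarrow> ereal) \<Rightarrow> ('n \<Rightarrow> real) \<Rightarrow> bool" where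
  "c_concave c \<psi> \<longleftrightarrow> (\<forall>y. c_superdifferential c \<psi> y \<noteq> {})"

(* A modulus is a function on the nonnegative reals; its values at negative arguments are
   irrelevant. "Increasing" is read in the weak sense. *)
definition modulus :: "(real \<Rightarrow> real) \<Rightarrow> bool" where
  "modulus \<omega> \<longleftrightarrow> \<omega> \<in> {0..} \<rightarrow> {0..} \<and> mono_on {0..} \<omega> \<and> \<omega> 0 = 0"

definition strongly_c_concave_on ::
    "('m \<times> 'n) set \<Rightarrow> (real \<Rightarrow> real) \<Rightarrow> ('m \<times> 'n::metric_space \<Rightarrow> ereal) \<Rightarrow> ('n \<Rightarrow> real) \<Rightarrow> bool"
    where
  "strongly_c_concave_on D \<omega> c \<psi> \<longleftrightarrow>
     c_concave c \<psi> \<and>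
     (\<forall>x y z. (x, y) \<in> D \<longrightarrow> (x, z) \<in> D \<longrightarrow> x \<in> c_superdifferential c \<psi> y \<longrightarrow>
        ereal (\<psi> z) - c (x, z) \<le> ereal (\<psi> y) - c (x, y) - ereal (\<omega> (dist y z)))"

definition supported_on :: "'a measure \<Rightarrow> 'a set \<Rightarrow> bool" where
  "supported_on \<gamma> D \<longleftrightarrow> emeasure \<gamma> (- D) = 0"

end

theory Submission
  imports Defs
begin

text \<open>
  Since \<open>T\<close> is induced by \<open>\<psi>\<close>, every \<open>x\<close> lies in the \<open>c\<close>-superdifferential of \<open>\<psi>\<close> at
  \<open>T x\<close>, so strong \<open>c\<close>-concavity on \<open>D\<close> gives, at \<open>\<gamma>\<close>-almost every \<open>(x, y)\<close>,

    \<open>\<omega> (dist (T x) y) + c (x, T x) + (\<psi> y - \<psi> (T x)) \<le> c (x, y)\<close>.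

  Both \<open>y\<close> and \<open>T x\<close> have law \<open>\<nu>\<close> under \<open>\<gamma>\<close>, so the difference of potentials should integrate to
  zero, which leaves the claim. The potential need not be \<open>\<nu>\<close>-integrable, however, so the two
  integrals of \<open>\<psi>\<close> cannot be subtracted. What survives without integrability is that the positive
  and the negative part of \<open>\<psi> y - \<psi> (T x)\<close> have the same integral in \<open>[0, \<infinity>]\<close>
  (\<open>nn_integral_diff_eq_of_distr_eq\<close>). If the plan has finite cost, the displayed inequality and the
  lower bound on \<open>c\<close> dominate the positive part by an integrable function; the common integral is
  then finite and cancels. If the plan has infinite cost, the right-hand side is \<open>\<infinity>\<close>.

  To avoid subtracting infinities, the pointwise inequality is integrated in a form in which each
  term is replaced by its positive and negative part and negative parts are moved to the other side
  (\<open>parts_inequality\<close>). Only the resulting numbers are subtracted.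
\<close>

lemma borel_measurable_lower_semicontinuous:
  assumes "lower_semicontinuous f"
  shows "f \<in> borel_measurable borel"
  unfolding borel_measurable_ereal_iff_Ioi
proof
  fix a
  have "f -` {a<..} = {x. a < f x}" by auto
  then have "open (f -` {a<..})"
    using assms by (simp add: lower_semicontinuous_def)
  then show "f -` {a<..} \<inter> space borel \<in> sets borel" by simp
qed

lemma borel_measurable_modulus:
  assumes "modulus \<omega>" "f \<in> borel_measurable M" "\<And>x. 0 \<le> f x"
  shows "(\<lambda>x. \<omega> (f x)) \<in> borel_measurable M"
proof -
  have \<omega>: "\<omega> \<in> borel_measurable (restrict_space borel {0..})"
    using assms(1) by (intro borel_measurable_mono_on_fnc) (simp add: modulus_def)
  have f: "f \<in> measurable M (restrict_space borel {0..})"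
    using assms by (intro measurable_restrict_space2) auto
  show ?thesis
    by (rule measurable_compose[OF f \<omega>])
qed

text \<open>
  For bounded \<open>u\<close> and \<open>v\<close> this is the vanishing of the integral of \<open>u - v\<close>. Clipping both functions
  to \<open>[-n, n]\<close> preserves the equality of their laws and reduces to that case; moreover the parts of
  the clipped difference increase with \<open>n\<close>, so monotone convergence applies even when the
  integrals diverge.
\<close>

lemma nn_integral_diff_eq_of_distr_eq:
  fixes u v :: "'a \<Rightarrow> real"
  assumes "finite_measure M"
    and [measurable]: "u \<in> borel_measurable M" "v \<in> borel_measurable M"
    and law: "distr M borel u = distr M borel v"
  shows "(\<integral>\<^sup>+ x. ennreal (u x - v x) \<partial>M) = (\<integral>\<^sup>+ x. ennreal (v x - u x) \<partial>M)"
proof -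
  interpret finite_measure M by fact
  define clip :: "nat \<Rightarrow> real \<Rightarrow> real" where "clip n t = max (- real n) (min (real n) t)" for n t
  have [measurable]: "clip n \<in> borel_measurable borel" for n
    unfolding clip_def by measurable
  have clip_abs: "\<bar>clip n t\<bar> \<le> real n" for n t
    by (auto simp: clip_def)
  have clip_parts_mono: "ennreal (clip m s - clip m t) \<le> ennreal (clip n s - clip n t)"
    if "m \<le> n" for m n s t
  proof (cases "t \<le> s")
    case True
    then show ?thesis
      using that unfolding clip_def
      by (intro ennreal_leI, cases "s \<le> m"; cases "t \<le> m"; cases "- m \<le> s"; cases "- m \<le> t"; simp)
  next
    case False
    then have "clip m s \<le> clip m t" by (simp add: clip_def)
    then show ?thesis by (simp add: ennreal_neg)
  qed
  have clip_lim: "(\<lambda>n. ennreal (clip n s - clip n t)) \<longlonglongrightarrow> ennreal (s - t)" for s t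
  proof (rule tendsto_eventually)
    obtain k :: nat where k: "max \<bar>s\<bar> \<bar>t\<bar> \<le> real k"
      using real_arch_simple by blast
    show "\<forall>\<^sub>F n in sequentially. ennreal (clip n s - clip n t) = ennreal (s - t)"
      using eventually_ge_at_top[of k]
    proof eventually_elim
      case (elim n)
      then have "max \<bar>s\<bar> \<bar>t\<bar> \<le> real n" using k by linarith
      then have "clip n s = s" "clip n t = t" by (auto simp: clip_def)
      then show ?case by simp
    qed
  qed
  have clip_nn_integral_lim:
    "(\<lambda>n. \<integral>\<^sup>+ x. ennreal (clip n (f x) - clip n (g x)) \<partial>M)
      \<longlonglongrightarrow> (\<integral>\<^sup>+ x. ennreal (f x - g x) \<partial>M)"
    if [measurable]: "f \<in> borel_measurable M" "g \<in> borel_measurable M" for f g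
    using clip_parts_mono clip_lim
    by (intro nn_integral_LIMSEQ) (auto simp: incseq_def le_fun_def)
  have clipped: "(\<integral>\<^sup>+ x. ennreal (clip n (u x) - clip n (v x)) \<partial>M)
      = (\<integral>\<^sup>+ x. ennreal (clip n (v x) - clip n (u x)) \<partial>M)" (is "?P = ?N") for n
  proof -
    have int: "integrable M (\<lambda>x. clip n (f x))" if [measurable]: "f \<in> borel_measurable M" for f
      using clip_abs by (intro integrable_const_bound[of _ "real n"]) auto
    have diff: "integrable M (\<lambda>x. clip n (u x) - clip n (v x))"
      by (intro Bochner_Integration.integrable_diff int) auto
    have "(\<integral>x. clip n (u x) \<partial>M) = (\<integral>t. clip n t \<partial>distr M borel u)"
      by (subst integral_distr) auto
    also have "\<dots> = (\<integral>x. clip n (v x) \<partial>M)"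
      unfolding law by (subst integral_distr) auto
    finally have "(\<integral>x. clip n (u x) - clip n (v x) \<partial>M) = 0"
      by (simp add: Bochner_Integration.integral_diff int)
    then have "enn2real ?P = enn2real ?N"
      unfolding real_lebesgue_integral_def[OF diff] by simp
    moreover have "?P < \<infinity>" "?N < \<infinity>"
      using diff unfolding real_integrable_def by (auto simp: less_top)
    ultimately show ?thesis
      by (cases ?P; cases ?N) auto
  qed
  show ?thesis
  proof (rule LIMSEQ_unique)
    show "(\<lambda>n. \<integral>\<^sup>+ x. ennreal (clip n (u x) - clip n (v x)) \<partial>M)
        \<longlonglongrightarrow> (\<integral>\<^sup>+ x. ennreal (u x - v x) \<partial>M)"
      by (rule clip_nn_integral_lim) auto
    show "(\<lambda>n. \<integral>\<^sup>+ x. ennreal (clip n (u x) - clip n (v x)) \<partial>M)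
        \<longlonglongrightarrow> (\<integral>\<^sup>+ x. ennreal (v x - u x) \<partial>M)"
      unfolding clipped by (rule clip_nn_integral_lim) auto
  qed
qed

text \<open>
  The second conclusion is what makes the positive part of \<open>q - p\<close> integrable: it drops the
  nonnegative terms \<open>w\<close> and \<open>e2ennreal a\<close> before splitting into parts.
\<close>

lemma parts_inequality:
  fixes a b :: ereal and p q w :: real
  assumes "a \<noteq> -\<infinity>" "b \<noteq> -\<infinity>" "b \<noteq> \<infinity>" "0 \<le> w"
    and "ereal q - b \<le> ereal p - a - ereal w"
  shows "ennreal w + e2ennreal a + e2ennreal (- b) + ennreal (q - p)
      \<le> e2ennreal b + e2ennreal (- a) + ennreal (p - q)"
    and "ennreal (q - p) \<le> e2ennreal b + e2ennreal (- a)"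
proof -
  obtain s where b: "b = ereal s" using assms by (cases b) auto
  \<comment> \<open>An infinite \<open>a\<close> would make the right-hand side of the hypothesis \<open>-\<infinity>\<close>.\<close>
  obtain r where a: "a = ereal r" using assms b by (cases a) auto
  have le: "w + r + (q - p) \<le> s" using assms by (simp add: a b)
  have pos: "ennreal t = ennreal (max 0 t)" for t
    by (simp add: ennreal_max_0)
  have "w + max 0 r + max 0 (- s) + max 0 (q - p) \<le> max 0 s + max 0 (- r) + max 0 (p - q)"
    using le by (simp add: max_def)
  then show "ennreal w + e2ennreal a + e2ennreal (- b) + ennreal (q - p)
      \<le> e2ennreal b + e2ennreal (- a) + ennreal (p - q)"
    unfolding a b uminus_ereal.simps e2ennreal_ereal
      pos[of r] pos[of "- s"] pos[of "q - p"] pos[of s] pos[of "- r"] pos[of "p - q"]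
    using \<open>0 \<le> w\<close> by (simp flip: ennreal_plus del: ennreal_max_0 ennreal_max_0')
  have "max 0 (q - p) \<le> max 0 s + max 0 (- r)"
    using le \<open>0 \<le> w\<close> by (simp add: max_def)
  then show "ennreal (q - p) \<le> e2ennreal b + e2ennreal (- a)"
    unfolding a b uminus_ereal.simps e2ennreal_ereal pos[of "q - p"] pos[of s] pos[of "- r"]
    by (simp flip: ennreal_plus del: ennreal_max_0 ennreal_max_0')
qed

lemma induced_by_potential_superdifferential:
  assumes "induced_by_potential c \<psi> T" and "\<And>z. c z \<noteq> -\<infinity>"
  shows "x \<in> c_superdifferential c \<psi> (T x)"
proof -
  have "ereal (\<psi> z) - c (x, z) \<le> ereal (\<psi> (T x)) - c (x, T x)" for z
  proof -
    have "\<not> c (x, z) - ereal (\<psi> z) < c (x, T x) - ereal (\<psi> (T x))"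
      using assms(1) by (simp add: induced_by_potential_def is_arg_min_def)
    then show ?thesis
      using assms(2)[of "(x, z)"] assms(2)[of "(x, T x)"]
      by (cases "c (x, z)"; cases "c (x, T x)") auto
  qed
  then show ?thesis by (simp add: c_superdifferential_def)
qed

lemma nn_integral_neg_part_finite:
  assumes "prob_space M" and "\<And>x. ereal b \<le> f x"
  shows "(\<integral>\<^sup>+ x. e2ennreal (- f x) \<partial>M) < \<infinity>"
proof -
  interpret prob_space M by fact
  have "e2ennreal (- f x) \<le> ennreal (- b)" for x
    using assms(2)[of x] by (metis e2ennreal_ereal e2ennreal_mono ereal_minus_le_minus uminus_ereal.simps(1))
  then have "(\<integral>\<^sup>+ x. e2ennreal (- f x) \<partial>M) \<le> (\<integral>\<^sup>+ x. ennreal (- b) \<partial>M)"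
    by (intro nn_integral_mono) auto
  also have "\<dots> < \<infinity>"
    by (simp add: emeasure_space_1)
  finally show ?thesis .
qed

theorem proposition8:
  fixes c :: "'m::polish_space \<times> 'n::polish_space \<Rightarrow> ereal"
    and \<mu> :: "'m measure" and \<nu> :: "'n measure"
    and T :: "'m \<Rightarrow> 'n" and \<psi> :: "'n \<Rightarrow> real" and \<omega> :: "real \<Rightarrow> real"
    and D :: "('m \<times> 'n) set" and \<gamma> :: "('m \<times> 'n) measure"
  assumes "lower_semicontinuous c" and "bounded_below c"
    and "\<mu> \<in> borel_prob" and "\<nu> \<in> borel_prob"
    and "optimal_transport_map c \<mu> \<nu> T"
    and "\<psi> \<in> borel_measurable (completion \<nu>)"
    and "induced_by_potential c \<psi> T"
    and "modulus \<omega>"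
    and "compact D" and "\<forall>x. (x, T x) \<in> D"
    and "strongly_c_concave_on D \<omega> c \<psi>"
    and "\<gamma> \<in> transport_plans \<mu> \<nu>" and "supported_on \<gamma> D"
  shows "ereal_integral \<gamma> (\<lambda>(x, y). ereal (\<omega> (dist (T x) y)))
       \<le> ereal_integral \<gamma> (\<lambda>(x, y). c (x, y)) - ereal_integral \<mu> (\<lambda>x. c (x, T x))"
proof -
  have sets_\<nu>: "sets \<nu> = sets borel" and sets_\<gamma>: "sets \<gamma> = sets borel"
    and "prob_space \<gamma>"
    and fst_\<gamma>: "distr \<gamma> borel fst = \<mu>" and snd_\<gamma>: "distr \<gamma> borel snd = \<nu>"
    using assms by (auto simp: borel_prob_def transport_plans_def)
  interpret \<gamma>: prob_space \<gamma> by fact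
  have T[measurable]: "T \<in> borel \<rightarrow>\<^sub>M borel" and T_\<nu>: "distr \<mu> borel T = \<nu>"
    using assms(5) by (auto simp: optimal_transport_map_def is_arg_min_def transport_map_def)
  have c[measurable]: "c \<in> borel_measurable borel"
    using assms(1) by (rule borel_measurable_lower_semicontinuous)
  have fst_meas[measurable]: "fst \<in> \<gamma> \<rightarrow>\<^sub>M borel" and snd_meas[measurable]: "snd \<in> \<gamma> \<rightarrow>\<^sub>M borel"
    by (auto intro!: borel_measurable_continuous_onI continuous_on_fst[OF continuous_on_id]
        continuous_on_snd[OF continuous_on_id] simp: measurable_cong_sets[OF sets_\<gamma> refl])
  obtain b :: real where b: "\<And>z. ereal b \<le> c z"
    using assms(2) by (auto simp: bounded_below_def)
  have c_ninf: "c z \<noteq> -\<infinity>" for z using b[of z] by auto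
  have \<omega>_nonneg: "0 \<le> \<omega> (dist s t)" for s t :: 'n
    using assms(8) by (auto simp: modulus_def)

  define TT where "TT z = T (fst z)" for z :: "'m \<times> 'n"
  have TT[measurable]: "TT \<in> \<gamma> \<rightarrow>\<^sub>M borel" 
    unfolding TT_def[abs_def] by (rule measurable_compose[OF fst_meas T])
  have TT_\<gamma>: "distr \<gamma> borel TT = \<nu>"
    using distr_distr[of T borel borel fst \<gamma>] by (simp add: fst_\<gamma> T_\<nu> TT_def[abs_def] comp_def)

  \<comment> \<open>The potential is evaluated only at \<open>y\<close> and at \<open>T x\<close>, both with law \<open>\<nu>\<close>, so changing it on
    a \<open>\<nu>\<close>-null set to make it Borel affects a \<open>\<gamma>\<close>-null set of pairs.\<close>
  obtain \<phi> where "\<phi> \<in> borel_measurable \<nu>" and \<phi>_AE: "AE y in \<nu>. \<psi> y = \<phi> y"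
    using completion_ex_borel_measurable_real[OF assms(6)] by blast
  then have [measurable]: "\<phi> \<in> borel_measurable borel"
    by (simp add: measurable_cong_sets[OF sets_\<nu> refl])
  have \<phi>_snd: "AE z in \<gamma>. \<psi> (snd z) = \<phi> (snd z)"
    by (rule AE_distrD[OF snd_meas]) (unfold snd_\<gamma>, fact \<phi>_AE)
  have \<phi>_TT: "AE z in \<gamma>. \<psi> (TT z) = \<phi> (TT z)"
    by (rule AE_distrD[OF TT]) (unfold TT_\<gamma>, fact \<phi>_AE)

  define w where "w z = \<omega> (dist (TT z) (snd z))" for z :: "'m \<times> 'n"
  have w[measurable]: "w \<in> borel_measurable \<gamma>"
    unfolding w_def[abs_def]
    by (intro borel_measurable_modulus[OF assms(8)] borel_measurable_dist[OF TT snd_meas] zero_le_dist)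
  have w_nonneg: "0 \<le> w z" for z by (simp add: w_def \<omega>_nonneg)
  define a where "a z = c (fst z, TT z)" for z :: "'m \<times> 'n"
  have cT[measurable]: "(\<lambda>x. c (x, T x)) \<in> borel_measurable borel"
    by (rule measurable_compose[OF borel_measurable_Pair[OF measurable_ident_sets[OF refl] T] c])
  have a_eq: "a z = c (fst z, T (fst z))" for z by (simp add: a_def TT_def)
  have a[measurable]: "a \<in> borel_measurable \<gamma>"
    unfolding a_eq[abs_def] by (rule measurable_compose[OF fst_meas cT])
  have c\<gamma>[measurable]: "c \<in> borel_measurable \<gamma>"
    using c by (simp add: measurable_cong_sets[OF sets_\<gamma> refl])

  define W where "W = (\<integral>\<^sup>+ z. ennreal (w z) \<partial>\<gamma>)"
  define A where "A = (\<integral>\<^sup>+ z. e2ennreal (a z) \<partial>\<gamma>)"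
  define A' where "A' = (\<integral>\<^sup>+ z. e2ennreal (- a z) \<partial>\<gamma>)"
  define C where "C = (\<integral>\<^sup>+ z. e2ennreal (c z) \<partial>\<gamma>)"
  define C' where "C' = (\<integral>\<^sup>+ z. e2ennreal (- c z) \<partial>\<gamma>)"
  define P where "P = (\<integral>\<^sup>+ z. ennreal (\<phi> (snd z) - \<phi> (TT z)) \<partial>\<gamma>)"

  have int_w: "ereal_integral \<gamma> (\<lambda>(x, y). ereal (\<omega> (dist (T x) y))) = enn2ereal W"
    by (simp add: ereal_integral_def W_def w_def TT_def case_prod_beta' ennreal_neg \<omega>_nonneg
        zero_ennreal.rep_eq)
  have int_c: "ereal_integral \<gamma> (\<lambda>(x, y). c (x, y)) = enn2ereal C - enn2ereal C'"
    by (simp add: ereal_integral_def C_def C'_def)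
  have "ereal_integral (distr \<gamma> borel fst) (\<lambda>x. c (x, T x)) = enn2ereal A - enn2ereal A'"
    by (simp add: ereal_integral_def A_def A'_def nn_integral_distr a_eq)
  then have int_a: "ereal_integral \<mu> (\<lambda>x. c (x, T x)) = enn2ereal A - enn2ereal A'"
    by (simp add: fst_\<gamma>)
  have "ereal b \<le> a z" for z by (simp add: a_def b)
  then have A'_fin: "A' < \<infinity>"
    unfolding A'_def by (rule nn_integral_neg_part_finite[OF \<open>prob_space \<gamma>\<close>])
  have C'_fin: "C' < \<infinity>"
    unfolding C'_def using \<open>prob_space \<gamma>\<close> b by (rule nn_integral_neg_part_finite)

  show ?thesis
  proof (cases "C = \<infinity>")
    case True
    \<comment> \<open>Subtraction of extended reals has \<open>\<infinity> - \<infinity> = \<infinity>\<close>, so a map of infinite cost is covered too.\<close>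
    then show ?thesis
      using C'_fin unfolding int_c
      by (cases C'; cases "ereal_integral \<mu> (\<lambda>x. c (x, T x))") (auto simp: enn2ereal_ennreal)
  next
    case False
    have "AE z in \<gamma>. e2ennreal (c z) \<noteq> \<infinity>"
      using False unfolding C_def by (intro nn_integral_noteq_infinite) auto
    moreover have "- D \<in> null_sets \<gamma>"
      using assms(9,13) by (auto simp: null_sets_def supported_on_def sets_\<gamma> compact_imp_closed
          intro!: borel_open)
    then have "AE z in \<gamma>. z \<in> D"
      by (auto dest: AE_not_in)
    ultimately have parts:
      "AE z in \<gamma>. ennreal (w z) + e2ennreal (a z) + e2ennreal (- c z) + ennreal (\<phi> (snd z) - \<phi> (TT z))
          \<le> e2ennreal (c z) + e2ennreal (- a z) + ennreal (\<phi> (TT z) - \<phi> (snd z))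
        \<and> ennreal (\<phi> (snd z) - \<phi> (TT z)) \<le> e2ennreal (c z) + e2ennreal (- a z)"
      using \<phi>_snd \<phi>_TT
    proof eventually_elim
      case (elim z)
      have "fst z \<in> c_superdifferential c \<psi> (TT z)"
        unfolding TT_def using assms(7) c_ninf by (rule induced_by_potential_superdifferential)
      moreover have "(fst z, TT z) \<in> D" "(fst z, snd z) \<in> D"
        using elim assms(10) by (auto simp: TT_def)
      ultimately have "ereal (\<psi> (snd z)) - c (fst z, snd z)
          \<le> ereal (\<psi> (TT z)) - c (fst z, TT z) - ereal (\<omega> (dist (TT z) (snd z)))"
        using assms(11) unfolding strongly_c_concave_on_def by blast
      then have "ereal (\<phi> (snd z)) - c z \<le> ereal (\<phi> (TT z)) - a z - ereal (w z)"
        using elim by (simp add: a_def w_def)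
      moreover have "c z \<noteq> \<infinity>"
        using elim by auto
      ultimately show ?case
        using parts_inequality[of "a z" "c z" "w z"] c_ninf w_nonneg by (auto simp: a_def)
    qed
    have "distr \<gamma> borel (\<lambda>z. \<phi> (snd z)) = distr \<nu> borel \<phi>"
      using distr_distr[of \<phi> borel borel snd \<gamma>] by (simp add: snd_\<gamma> comp_def)
    also have "\<dots> = distr \<gamma> borel (\<lambda>z. \<phi> (TT z))"
      using distr_distr[of \<phi> borel borel TT \<gamma>] by (simp add: TT_\<gamma> comp_def)
    finally have P_eq: "P = (\<integral>\<^sup>+ z. ennreal (\<phi> (TT z) - \<phi> (snd z)) \<partial>\<gamma>)"
      unfolding P_def by (intro nn_integral_diff_eq_of_distr_eq \<gamma>.finite_measure_axioms) auto
    have "P \<le> (\<integral>\<^sup>+ z. e2ennreal (c z) + e2ennreal (- a z) \<partial>\<gamma>)"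
      unfolding P_def using parts by (intro nn_integral_mono_AE) auto
    also have "\<dots> = C + A'"
      by (simp add: C_def A'_def nn_integral_add)
    finally have "P \<noteq> \<infinity>"
      using False A'_fin by (auto simp: top_unique)
    have "(\<integral>\<^sup>+ z. ennreal (w z) + e2ennreal (a z) + e2ennreal (- c z)
          + ennreal (\<phi> (snd z) - \<phi> (TT z)) \<partial>\<gamma>)
        \<le> (\<integral>\<^sup>+ z. e2ennreal (c z) + e2ennreal (- a z) + ennreal (\<phi> (TT z) - \<phi> (snd z)) \<partial>\<gamma>)"
      using parts by (intro nn_integral_mono_AE) auto
    then have "W + A + C' + P \<le> C + A' + P"
      unfolding P_eq by (simp add: W_def A_def A'_def C_def C'_def P_def nn_integral_add
          flip: P_eq)
    then have le: "W + A + C' \<le> C + A'"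
      using \<open>P \<noteq> \<infinity>\<close> by (simp add: add.commute[of _ P] ennreal_add_left_cancel_le)
    then have "W + A + C' < \<infinity>"
      using False A'_fin by (auto simp: less_top[symmetric] top_unique)
    then obtain rW rA rC' where "W = ennreal rW" "A = ennreal rA" "C' = ennreal rC'"
      "0 \<le> rW" "0 \<le> rA" "0 \<le> rC'"
      by (cases W; cases A; cases C') auto
    moreover obtain rC rA' where "C = ennreal rC" "A' = ennreal rA'" "0 \<le> rC" "0 \<le> rA'"
      using False A'_fin by (cases C; cases A') auto
    ultimately show ?thesis
      using le unfolding int_w int_c int_a
      by (simp add: enn2ereal_ennreal flip: ennreal_plus)
  qed
qed

end
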